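(* For $D>0$, $L>0$, $\theta\in(-\pi/2,\pi/2)$ let $$\overline{\mathsf{SNR}}_0^{(1)}(\theta,D/L)=\frac{\pi}{4D^2\psi_2}\left(\frac DL\right)^2\frac{\psi_2\Delta-1}{\psi_2\Delta+1},\qquad \Delta=\sqrt{(D^2-L^2)^2+(2LD\cos\theta)^2},$$ with $\psi_2$ as defined in the context (the right-hand side depends only on $\theta$ and the ratio $D/L$). Then for any fixed $\theta\in(-\pi/2,\pi/2)$, $$\lim_{D/L\to\infty}\overline{\mathsf{SNR}}_0^{(1)}(\theta,D/L)=\frac{\pi}{12}\cos^2\theta.$$
   Context: For $D>0$, $L>0$, $\theta\in(-\pi/2,\pi/2)$ define $$\Gamma=\arctan\frac{L/D-\sin\theta}{\cos\theta}+\arctan\frac{L/D+\sin\theta}{\cos\theta},\qquad \psi_2=\frac{\Gamma}{2LD\cos\theta}.$$ Interpretation: $\overline{\mathsf{SNR}}_0^{(1)}(\theta,D/L)$ is the SNR at a reference point (broadside, at distance $L$ from the array) above which at least two spatial streams are optimal at the receiver position $(D,\theta)$ when transmitter and receiver both use three polarizations. *)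

theory Defs
  imports Complex_Main
begin

definition Gamma_ang :: "real \<Rightarrow> real \<Rightarrow> real \<Rightarrow> real" where
  "Gamma_ang D L \<theta> =
     arctan ((L / D - sin \<theta>) / cos \<theta>) + arctan ((L / D + sin \<theta>) / cos \<theta>)"

definition psi2 :: "real \<Rightarrow> real \<Rightarrow> real \<Rightarrow> real" where
  "psi2 D L \<theta> = Gamma_ang D L \<theta> / (2 * L * D * cos \<theta>)"

definition Delta :: "real \<Rightarrow> real \<Rightarrow> real \<Rightarrow> real" where
  "Delta D L \<theta> = sqrt ((D\<^sup>2 - L\<^sup>2)\<^sup>2 + (2 * L * D * cos \<theta>)\<^sup>2)"

text \<open>The threshold is a function of the angle and the ratio of \<open>D\<close> to \<open>L\<close> only, but is
  given by a formula in \<open>D\<close> and \<open>L\<close>, so both are kept as arguments.\<close>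

definition SNR_threshold :: "real \<Rightarrow> real \<Rightarrow> real \<Rightarrow> real" where
  "SNR_threshold \<theta> D L =
     pi / (4 * D\<^sup>2 * psi2 D L \<theta>) * (D / L)\<^sup>2
       * ((psi2 D L \<theta> * Delta D L \<theta> - 1) / (psi2 D L \<theta> * Delta D L \<theta> + 1))"

text \<open>The limit \<open>D / L \<rightarrow> \<infinity>\<close> over all pairs of positive reals, with neither held fixed.\<close>

definition ratio_at_top :: "(real \<times> real) filter" where
  "ratio_at_top =
     inf (filtercomap (\<lambda>(D, L). D / L) at_top) (principal ({0<..} \<times> {0<..}))"

end

(* With x = L/D and c = cos \<theta>, the threshold is a function of x alone. For small x the
   addition theorem for arctan collapses the two arctangents to arctan (2 c x / (1 - x^2)), so
   that sin \<theta> disappears and the limit x \<rightarrow> 0+ is a Taylor expansion with the single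
   parameter c > 0: writing G for the angle and q for Delta / D^2, the numerator G q - 2 c x
   is 4/3 c^3 x^3 + o(x^3) and the denominator G q + 2 c x is 4 c x + o(x). *)
theory Submission
  imports Defs "HOL-Analysis.Complex_Transcendental" "HOL-Real_Asymp.Real_Asymp"
begin

text \<open>For positive \<open>x\<close> and \<open>cos \<theta>\<close> this is the threshold at
  \<open>D = 1\<close>, \<open>L = x\<close>, with the inner fractions cleared by the factor
  \<open>2 * x * cos \<theta>\<close>.\<close>

definition threshold_of_inverse_ratio :: "real \<Rightarrow> real \<Rightarrow> real" where
  "threshold_of_inverse_ratio \<theta> x =
     (let G = Gamma_ang 1 x \<theta>; q = sqrt ((1 - x\<^sup>2)\<^sup>2 + (2 * x * cos \<theta>)\<^sup>2)
      in pi * cos \<theta> / (2 * G * x) * ((G * q - 2 * x * cos \<theta>) / (G * q + 2 * x * cos \<theta>)))"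

lemma Delta_scale:
  assumes "D > 0"
  shows "Delta D L \<theta> = D\<^sup>2 * sqrt ((1 - (L / D)\<^sup>2)\<^sup>2 + (2 * (L / D) * cos \<theta>)\<^sup>2)"
proof -
  have "(D\<^sup>2 - L\<^sup>2)\<^sup>2 + (2 * L * D * cos \<theta>)\<^sup>2
      = (D\<^sup>2)\<^sup>2 * ((1 - (L / D)\<^sup>2)\<^sup>2 + (2 * (L / D) * cos \<theta>)\<^sup>2)"
    using assms by (simp add: field_simps power2_eq_square)
  then show ?thesis
    unfolding Delta_def by (simp only: real_sqrt_mult real_sqrt_abs abs_power2)
qed

text \<open>At a fixed ratio, \<open>psi2\<close> scales like the inverse square of \<open>D\<close>
  and \<open>Delta\<close> like the square, so both \<open>psi2 * Delta\<close> and the prefactor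
  are scale-free.\<close>

lemma SNR_threshold_ratio:
  assumes "D > 0" "L > 0" "cos \<theta> > 0"
  shows "SNR_threshold \<theta> D L = threshold_of_inverse_ratio \<theta> (L / D)"
proof -
  define x c q G where "x = L / D" and "c = cos \<theta>"
    and "q = sqrt ((1 - x\<^sup>2)\<^sup>2 + (2 * x * c)\<^sup>2)" and "G = Gamma_ang D L \<theta>"
  have pos: "x > 0" "c > 0" and L: "L = x * D"
    using assms by (simp_all add: x_def c_def)
  have psi: "psi2 D L \<theta> = G / (2 * x * c) / D\<^sup>2"
    using assms by (simp add: psi2_def G_def c_def L power2_eq_square)
  have Delta: "Delta D L \<theta> = D\<^sup>2 * q"
    unfolding q_def x_def c_def by (rule Delta_scale[OF assms(1)])
  have psi_Delta: "psi2 D L \<theta> * Delta D L \<theta> = G * q / (2 * x * c)"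
    using assms by (simp add: psi Delta)
  have frac: "(G * q / (2 * x * c) - 1) / (G * q / (2 * x * c) + 1)
      = (G * q - 2 * x * c) / (G * q + 2 * x * c)"
  proof -
    have "G * q / (2 * x * c) - 1 = (G * q - 2 * x * c) / (2 * x * c)"
      and "G * q / (2 * x * c) + 1 = (G * q + 2 * x * c) / (2 * x * c)"
      using pos by (simp_all add: field_simps)
    then show ?thesis using pos by simp
  qed
  have "pi / (4 * D\<^sup>2 * psi2 D L \<theta>) * (D / L)\<^sup>2 = pi * c / (2 * G * x)"
    using assms pos by (simp add: psi) (simp add: L power2_eq_square)
  moreover have "Gamma_ang 1 x \<theta> = G"
    by (simp add: Gamma_ang_def G_def x_def)
  ultimately show ?thesis
    unfolding SNR_threshold_def threshold_of_inverse_ratio_def Let_def psi_Delta frac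
    by (simp add: x_def c_def q_def)
qed

text \<open>The addition theorem holds without a correction by a multiple of \<open>pi\<close> only
  while the sum of the two angles stays within \<open>pi / 2\<close> of zero. Continuity at
  \<open>x = 0\<close> ensures this for small \<open>x\<close>.\<close>

lemma eventually_Gamma_ang_eq_arctan:
  assumes "cos \<theta> > 0"
  shows "\<forall>\<^sub>F x in at_right 0. Gamma_ang 1 x \<theta> = arctan (2 * cos \<theta> * x / (1 - x\<^sup>2))"
proof -
  have "((\<lambda>x. Gamma_ang 1 x \<theta>) \<longlongrightarrow> Gamma_ang 1 0 \<theta>) (at_right 0)"
    unfolding Gamma_ang_def using assms by (auto intro!: tendsto_eq_intros)
  \<comment> \<open>At \<open>x = 0\<close> the two arguments are \<open>- tan \<theta>\<close> and
    \<open>tan \<theta>\<close>, so the angles cancel.\<close>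
  moreover have "Gamma_ang 1 0 \<theta> = 0"
    by (simp add: Gamma_ang_def arctan_minus)
  ultimately have "((\<lambda>x. \<bar>Gamma_ang 1 x \<theta>\<bar>) \<longlongrightarrow> 0) (at_right 0)"
    by (simp add: tendsto_rabs_zero)
  then have "\<forall>\<^sub>F x in at_right 0. \<bar>Gamma_ang 1 x \<theta>\<bar> < pi / 2"
    by (rule order_tendstoD) simp
  then show ?thesis
  proof eventually_elim
    case (elim x)
    define c s where "c = cos \<theta>" and "s = sin \<theta>"
    have c: "c > 0" and sc: "c\<^sup>2 = 1 - s\<^sup>2"
      using assms by (simp_all add: c_def s_def cos_squared_eq)
    have "arctan ((x - s) / c) + arctan ((x + s) / c)
        = arctan (((x - s) / c + (x + s) / c) / (1 - (x - s) / c * ((x + s) / c)))"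
      by (rule arctan_add_raw) (use elim in \<open>auto simp: Gamma_ang_def c_def s_def\<close>)
    also have "(x - s) / c + (x + s) / c = 2 * x / c"
      by (simp add: add_divide_distrib[symmetric])
    also have "1 - (x - s) / c * ((x + s) / c) = (c\<^sup>2 - (x\<^sup>2 - s\<^sup>2)) / c\<^sup>2"
      using c by (simp add: field_simps power2_eq_square)
    \<comment> \<open>Here the sine drops out, by the Pythagorean identity.\<close>
    also have "c\<^sup>2 - (x\<^sup>2 - s\<^sup>2) = 1 - x\<^sup>2"
      by (simp add: sc)
    also have "2 * x / c / ((1 - x\<^sup>2) / c\<^sup>2) = 2 * c * x / (1 - x\<^sup>2)"
      using c by (simp add: power2_eq_square)
    finally show ?case
      by (simp add: Gamma_ang_def c_def s_def)
  qed
qed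

lemma threshold_of_inverse_ratio_tendsto:
  assumes "cos \<theta> > 0"
  shows "(threshold_of_inverse_ratio \<theta> \<longlongrightarrow> pi / 12 * (cos \<theta>)\<^sup>2) (at_right 0)"
proof -
  \<comment> \<open>The cosine is generalized to an arbitrary \<open>c > 0\<close>, a symbolic
    parameter of the expansion. The prefactor behaves like \<open>pi / (4 * x^2)\<close> and the
    quotient like \<open>c^2 * x^2 / 3\<close>.\<close>
  have "((\<lambda>x. let G = arctan (2 * c * x / (1 - x\<^sup>2)); q = sqrt ((1 - x\<^sup>2)\<^sup>2 + (2 * x * c)\<^sup>2)
      in pi * c / (2 * G * x) * ((G * q - 2 * x * c) / (G * q + 2 * x * c)))
      \<longlongrightarrow> pi / 12 * c\<^sup>2) (at_right 0)" if "c > 0" for c :: real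
    unfolding Let_def using that by (real_asymp simp: field_simps power2_eq_square)
  from this[OF assms] show ?thesis
    by (rule Lim_transform_eventually)
      (use eventually_Gamma_ang_eq_arctan[OF assms] in eventually_elim,
       simp add: threshold_of_inverse_ratio_def)
qed

lemma inverse_ratio_tendsto_zero:
  "filterlim (\<lambda>(D, L). L / D) (at_right 0) ratio_at_top"
proof -
  have "filterlim (\<lambda>(D, L). D / L) at_top ratio_at_top"
    \<comment> \<open>\<open>D / L\<close> tends to infinity along the \<open>filtercomap\<close> by
      construction, and the infimum with the positive quadrant is a finer filter.\<close>
    unfolding ratio_at_top_def by (rule filterlim_mono[OF filterlim_filtercomap order.refl inf_le1])
  then have "filterlim (\<lambda>p. inverse (case p of (D, L) \<Rightarrow> D / L)) (at_right 0) ratio_at_top"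
    by (rule filterlim_compose[OF filterlim_inverse_at_right_top])
  then show ?thesis
    by (simp add: case_prod_unfold)
qed

theorem mainTheorem5:
  fixes \<theta> :: real
  assumes "- pi / 2 < \<theta>" and "\<theta> < pi / 2"
  shows "(\<forall>D > 0. \<forall>L > 0. \<forall>D' > 0. \<forall>L' > 0.
            D / L = D' / L' \<longrightarrow> SNR_threshold \<theta> D L = SNR_threshold \<theta> D' L')
       \<and> ((\<lambda>(D, L). SNR_threshold \<theta> D L) \<longlongrightarrow> pi / 12 * (cos \<theta>)\<^sup>2) ratio_at_top"
proof
  have cos: "cos \<theta> > 0"
    using assms by (intro cos_gt_zero_pi) auto
  note ratio = SNR_threshold_ratio[OF _ _ cos]
  show "\<forall>D > 0. \<forall>L > 0. \<forall>D' > 0. \<forall>L' > 0.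
          D / L = D' / L' \<longrightarrow> SNR_threshold \<theta> D L = SNR_threshold \<theta> D' L'"
  proof (intro allI impI)
    fix D L D' L' :: real
    assume pos: "D > 0" "L > 0" "D' > 0" "L' > 0" and eq: "D / L = D' / L'"
    have "L / D = L' / D'"
      using arg_cong[OF eq, of inverse] by simp
    then show "SNR_threshold \<theta> D L = SNR_threshold \<theta> D' L'"
      using pos by (simp add: ratio)
  qed
  have "((\<lambda>p. threshold_of_inverse_ratio \<theta> (case p of (D, L) \<Rightarrow> L / D))
      \<longlongrightarrow> pi / 12 * (cos \<theta>)\<^sup>2) ratio_at_top"
    by (rule filterlim_compose[OF threshold_of_inverse_ratio_tendsto[OF cos]
          inverse_ratio_tendsto_zero])
  \<comment> \<open>The reduction to the ratio was shown for positive \<open>D\<close> and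
    \<open>L\<close>; the principal part of the filter supplies this positivity.\<close>
  moreover have "\<forall>\<^sub>F p in ratio_at_top. p \<in> {0<..} \<times> {0<..}"
    unfolding ratio_at_top_def eventually_inf_principal by simp
  then have "\<forall>\<^sub>F p in ratio_at_top. threshold_of_inverse_ratio \<theta> (case p of (D, L) \<Rightarrow> L / D)
      = (case p of (D, L) \<Rightarrow> SNR_threshold \<theta> D L)"
    by eventually_elim (auto simp: ratio)
  ultimately show "((\<lambda>(D, L). SNR_threshold \<theta> D L) \<longlongrightarrow> pi / 12 * (cos \<theta>)\<^sup>2) ratio_at_top"
    by (rule Lim_transform_eventually)
qed

end
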